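(* Let $X,G$ be bounded degree graphs with adjacency operators $A,B$, and let $Y$ be a bounded degree graph obtained from $X$ and $G$ by adding and/or removing edges of $X$ and by linking $G$ to $X$, so that its adjacency operator on $\ell^2(X)\oplus\ell^2(G)$ is $$A_p=\begin{pmatrix}A+D&C\\ C^t&B\end{pmatrix}.$$ For $\lambda\notin\sigma(A)\cup\sigma(B)$ set $$S(\lambda)=\big(DR_A(\lambda)+CR_B(\lambda)C^tR_A(\lambda)\big)\big|_{\overline{\mathcal R(C)+\mathcal R(D)}} .$$ Then $\lambda\notin\sigma(A)\cup\sigma(B)$ is an eigenvalue of $A_p$ if and only if $1$ is an eigenvalue of $S(\lambda)$. If this is the case, the corresponding eigenvectors $\begin{pmatrix} x \\ y \end{pmatrix}$ of $A_p$ and $z$ of $S(\lambda)$ are related by $$z=Dx+Cy,\qquad x=R_A(\lambda)z,\qquad y=R_B(\lambda)C^tR_A(\lambda)z .$$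
   Context: $R_T(\lambda)=(\lambda I-T)^{-1}$ is the resolvent of $T$ for $\lambda\notin\sigma(T)$; $\mathcal R(T)$ is the range of $T$. $D$ describes the edges added to and/or removed from $X$ and $C:\ell^2(G)\to\ell^2(X)$ describes the edges linking $G$ to $X$; both are bounded since $Y$ has bounded degree. $S(\lambda)$ is regarded as an operator on the closed subspace $\overline{\mathcal R(C)+\mathcal R(D)}$ of $\ell^2(X)$. Eigenvectors are in $\ell^2$. *)

theory Defs
  imports "HOL-Analysis.Analysis"
begin

section \<open>Complex vector spaces\<close>

class complex_normed_vector = real_normed_vector +
  fixes scaleC :: "complex \<Rightarrow> 'a \<Rightarrow> 'a"  (infixr \<open>*\<^sub>C\<close> 75)
  assumes scaleC_add_right: "a *\<^sub>C (x + y) = a *\<^sub>C x + a *\<^sub>C y"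
    and scaleC_add_left: "(a + b) *\<^sub>C x = a *\<^sub>C x + b *\<^sub>C x"
    and scaleC_scaleC: "a *\<^sub>C (b *\<^sub>C x) = (a * b) *\<^sub>C x"
    and scaleC_one: "1 *\<^sub>C x = x"
    and scaleR_scaleC: "r *\<^sub>R x = complex_of_real r *\<^sub>C x"
    and norm_scaleC: "norm (a *\<^sub>C x) = cmod a * norm x"

text \<open>The library norm on a product is \<open>sqrt (norm x ^ 2 + norm y ^ 2)\<close>, so the product type is
  the Hilbert space direct sum.\<close>

instantiation prod :: (complex_normed_vector, complex_normed_vector) complex_normed_vector
begin

definition scaleC_prod where
  "scaleC_prod a p = (a *\<^sub>C fst p, a *\<^sub>C snd p)"

instance
proof
  fix a b :: complex and x y :: "'a \<times> 'b" and r :: real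
  show "a *\<^sub>C (x + y) = a *\<^sub>C x + a *\<^sub>C y" by (simp add: scaleC_prod_def scaleC_add_right)
  show "(a + b) *\<^sub>C x = a *\<^sub>C x + b *\<^sub>C x" by (simp add: scaleC_prod_def scaleC_add_left)
  show "a *\<^sub>C (b *\<^sub>C x) = (a * b) *\<^sub>C x" by (simp add: scaleC_prod_def scaleC_scaleC)
  show "1 *\<^sub>C x = x" by (simp add: scaleC_prod_def scaleC_one)
  show "r *\<^sub>R x = complex_of_real r *\<^sub>C x"
    by (simp add: scaleC_prod_def scaleR_scaleC scaleR_prod_def)
  have "(cmod a * norm (fst x))\<^sup>2 + (cmod a * norm (snd x))\<^sup>2
      = (cmod a)\<^sup>2 * ((norm (fst x))\<^sup>2 + (norm (snd x))\<^sup>2)"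
    by (simp add: power_mult_distrib distrib_left)
  then show "norm (a *\<^sub>C x) = cmod a * norm x"
    by (simp add: scaleC_prod_def norm_prod_def norm_scaleC real_sqrt_mult)
qed

end

section \<open>The space of square-summable functions\<close>

typedef 'a ell2 = "{f :: 'a \<Rightarrow> complex. (\<lambda>a. (cmod (f a))\<^sup>2) summable_on UNIV}"
  morphisms ell2_apply Abs_ell2
  by (rule exI[of _ "\<lambda>_. 0"]) simp

setup_lifting type_definition_ell2

lemma ell2_summable: "(\<lambda>a. (cmod (ell2_apply f a))\<^sup>2) summable_on UNIV"
  using ell2_apply[of f] by simp

lemma ell2_eqI: "(\<And>a. ell2_apply f a = ell2_apply g a) \<Longrightarrow> f = g"
  by (metis ell2_apply_inject ext)

lemma square_summableI:
  assumes "\<And>F. finite F \<Longrightarrow> (\<Sum>a\<in>F. (cmod (f a))\<^sup>2) \<le> K"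
  shows "(\<lambda>a. (cmod (f a))\<^sup>2) summable_on UNIV"
  by (rule nonneg_bdd_above_summable_on) (auto intro!: bdd_aboveI[where M = K] assms)

lemma L2_set_le_sqrt_infsum:
  assumes "(\<lambda>a. (cmod (f a))\<^sup>2) summable_on UNIV" and "finite F"
  shows "L2_set (\<lambda>a. cmod (f a)) F \<le> sqrt (\<Sum>\<^sub>\<infinity>a. (cmod (f a))\<^sup>2)"
  unfolding L2_set_def
  by (rule real_sqrt_le_mono, rule finite_sum_le_infsum) (use assms in auto)

lemma L2_set_add_le:
  assumes "(\<lambda>a. (cmod (f a))\<^sup>2) summable_on UNIV" "(\<lambda>a. (cmod (g a))\<^sup>2) summable_on UNIV" "finite F"
  shows "(\<Sum>a\<in>F. (cmod (f a + g a))\<^sup>2)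
    \<le> (sqrt (\<Sum>\<^sub>\<infinity>a. (cmod (f a))\<^sup>2) + sqrt (\<Sum>\<^sub>\<infinity>a. (cmod (g a))\<^sup>2))\<^sup>2"
proof -
  have "L2_set (\<lambda>a. cmod (f a + g a)) F \<le> L2_set (\<lambda>a. cmod (f a) + cmod (g a)) F"
    by (rule L2_set_mono) (auto intro: norm_triangle_ineq)
  also have "\<dots> \<le> L2_set (\<lambda>a. cmod (f a)) F + L2_set (\<lambda>a. cmod (g a)) F"
    by (rule L2_set_triangle_ineq)
  also have "\<dots> \<le> sqrt (\<Sum>\<^sub>\<infinity>a. (cmod (f a))\<^sup>2) + sqrt (\<Sum>\<^sub>\<infinity>a. (cmod (g a))\<^sup>2)"
    by (intro add_mono L2_set_le_sqrt_infsum assms)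
  finally have "L2_set (\<lambda>a. cmod (f a + g a)) F
      \<le> sqrt (\<Sum>\<^sub>\<infinity>a. (cmod (f a))\<^sup>2) + sqrt (\<Sum>\<^sub>\<infinity>a. (cmod (g a))\<^sup>2)" .
  then show ?thesis
    unfolding L2_set_def by (rule sqrt_le_D)
qed

instantiation ell2 :: (type) complex_normed_vector
begin

lift_definition zero_ell2 :: "'a ell2" is "\<lambda>_. 0" by simp
lift_definition plus_ell2 :: "'a ell2 \<Rightarrow> 'a ell2 \<Rightarrow> 'a ell2" is "\<lambda>f g a. f a + g a"
  by (rule square_summableI) (rule L2_set_add_le)
lift_definition uminus_ell2 :: "'a ell2 \<Rightarrow> 'a ell2" is "\<lambda>f a. - f a" by simp
lift_definition minus_ell2 :: "'a ell2 \<Rightarrow> 'a ell2 \<Rightarrow> 'a ell2" is "\<lambda>f g a. f a - g a"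
proof -
  fix f g :: "'a \<Rightarrow> complex"
  assume "(\<lambda>a. (cmod (f a))\<^sup>2) summable_on UNIV" "(\<lambda>a. (cmod (g a))\<^sup>2) summable_on UNIV"
  then have "(\<Sum>a\<in>F. (cmod (f a + - g a))\<^sup>2)
      \<le> (sqrt (\<Sum>\<^sub>\<infinity>a. (cmod (f a))\<^sup>2) + sqrt (\<Sum>\<^sub>\<infinity>a. (cmod (- g a))\<^sup>2))\<^sup>2" if "finite F" for F
    by (intro L2_set_add_le that) simp_all
  then show "(\<lambda>a. (cmod (f a - g a))\<^sup>2) summable_on UNIV"
    by (intro square_summableI) simp
qed
lift_definition scaleC_ell2 :: "complex \<Rightarrow> 'a ell2 \<Rightarrow> 'a ell2" is "\<lambda>c f a. c * f a"
  by (simp add: norm_mult power_mult_distrib summable_on_cmult_right)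
definition scaleR_ell2 :: "real \<Rightarrow> 'a ell2 \<Rightarrow> 'a ell2"
  where "scaleR_ell2 r f = complex_of_real r *\<^sub>C f"
lift_definition norm_ell2 :: "'a ell2 \<Rightarrow> real" is "\<lambda>f. sqrt (\<Sum>\<^sub>\<infinity>a. (cmod (f a))\<^sup>2)" .
definition dist_ell2 :: "'a ell2 \<Rightarrow> 'a ell2 \<Rightarrow> real"
  where "dist_ell2 f g = norm (f - g)"
definition sgn_ell2 :: "'a ell2 \<Rightarrow> 'a ell2"
  where "sgn_ell2 f = scaleR (inverse (norm f)) f"
definition "(uniformity :: ('a ell2 \<times> 'a ell2) filter)
  = (INF e\<in>{0<..}. principal {(f, g). dist f g < e})"
definition "open_ell2 (U :: 'a ell2 set)
  \<longleftrightarrow> (\<forall>f\<in>U. eventually (\<lambda>(f', g). f' = f \<longrightarrow> g \<in> U) uniformity)"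

instance
proof
  fix a b :: complex and f g h :: "'a ell2" and r s :: real and U :: "'a ell2 set"
  note apply_simps = zero_ell2.rep_eq plus_ell2.rep_eq uminus_ell2.rep_eq minus_ell2.rep_eq
    scaleC_ell2.rep_eq scaleR_ell2_def algebra_simps
  show "f + g + h = f + (g + h)" by (rule ell2_eqI) (simp add: apply_simps)
  show "f + g = g + f" by (rule ell2_eqI) (simp add: apply_simps)
  show "0 + f = f" by (rule ell2_eqI) (simp add: apply_simps)
  show "- f + f = 0" by (rule ell2_eqI) (simp add: apply_simps)
  show "f - g = f + - g" by (rule ell2_eqI) (simp add: apply_simps)
  show "a *\<^sub>C (f + g) = a *\<^sub>C f + a *\<^sub>C g" by (rule ell2_eqI) (simp add: apply_simps)
  show "(a + b) *\<^sub>C f = a *\<^sub>C f + b *\<^sub>C f" by (rule ell2_eqI) (simp add: apply_simps)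
  show "a *\<^sub>C (b *\<^sub>C f) = (a * b) *\<^sub>C f" by (rule ell2_eqI) (simp add: apply_simps)
  show "1 *\<^sub>C f = f" by (rule ell2_eqI) (simp add: apply_simps)
  show "scaleR r f = complex_of_real r *\<^sub>C f" by (rule scaleR_ell2_def)
  show "scaleR r (f + g) = scaleR r f + scaleR r g" by (rule ell2_eqI) (simp add: apply_simps)
  show "scaleR (r + s) f = scaleR r f + scaleR s f" by (rule ell2_eqI) (simp add: apply_simps)
  show "scaleR r (scaleR s f) = scaleR (r * s) f" by (rule ell2_eqI) (simp add: apply_simps)
  show "scaleR 1 f = f" by (rule ell2_eqI) (simp add: apply_simps)
  show nC: "norm (a *\<^sub>C f) = cmod a * norm f" for a
    by (simp add: norm_ell2.rep_eq scaleC_ell2.rep_eq norm_mult power_mult_distrib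
        infsum_cmult_right' real_sqrt_mult)
  show "norm (scaleR r f) = \<bar>r\<bar> * norm f"
    by (simp add: scaleR_ell2_def nC)
  show "norm f = 0 \<longleftrightarrow> f = 0"
  proof
    assume "norm f = 0"
    then have "(cmod (ell2_apply f a))\<^sup>2 = 0" for a
      by (intro nonneg_infsum_le_0D[OF _ ell2_summable[of f]]) (simp_all add: norm_ell2.rep_eq)
    then show "f = 0" by (intro ell2_eqI) (simp add: zero_ell2.rep_eq)
  qed (simp add: norm_ell2.rep_eq zero_ell2.rep_eq)
  show "norm (f + g) \<le> norm f + norm g"
  proof -
    have "(\<Sum>\<^sub>\<infinity>a. (cmod (ell2_apply (f + g) a))\<^sup>2) \<le> (norm f + norm g)\<^sup>2"
    proof (rule infsum_le_finite_sums[OF ell2_summable])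
      fix F :: "'a set" assume "finite F"
      then show "(\<Sum>a\<in>F. (cmod (ell2_apply (f + g) a))\<^sup>2) \<le> (norm f + norm g)\<^sup>2"
        using L2_set_add_le[OF ell2_summable[of f] ell2_summable[of g]]
        by (simp add: plus_ell2.rep_eq norm_ell2.rep_eq)
    qed
    moreover have "0 \<le> norm f + norm g" by (simp add: norm_ell2.rep_eq infsum_nonneg)
    ultimately show ?thesis
      by (subst (1) norm_ell2.rep_eq) (rule real_le_lsqrt)
  qed
  show "dist f g = norm (f - g)" by (rule dist_ell2_def)
  show "sgn f = scaleR (inverse (norm f)) f" by (rule sgn_ell2_def)
  show "(uniformity :: ('a ell2 \<times> 'a ell2) filter)
      = (INF e\<in>{0<..}. principal {(f, g). dist f g < e})"
    by (rule uniformity_ell2_def)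
  show "open U \<longleftrightarrow> (\<forall>f\<in>U. eventually (\<lambda>(f', g). f' = f \<longrightarrow> g \<in> U) uniformity)"
    by (rule open_ell2_def)
qed

end

text \<open>\<open>ell2_on V\<close> is the Hilbert space of square-summable functions on the set \<open>V\<close>, realised as the
  closed subspace of functions on the whole type that vanish outside \<open>V\<close>. In this way \<open>V\<close> may be an
  arbitrary, possibly empty, vertex set.\<close>

definition ell2_on :: "'a set \<Rightarrow> 'a ell2 set" where
  "ell2_on V = {f. \<forall>a. a \<notin> V \<longrightarrow> ell2_apply f a = 0}"

section \<open>Spectrum, resolvent and eigenvectors of an operator on a subspace\<close>

text \<open>In this section \<open>T\<close> is an operator on the space \<open>H\<close>; its values outside \<open>H\<close> are irrelevant.
  The complex number \<open>z\<close> is in the resolvent set if \<open>z I - T\<close> is a bijection of \<open>H\<close> with bounded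
  inverse.\<close>

definition spectrum_on ::
  "'a::complex_normed_vector set \<Rightarrow> ('a \<Rightarrow> 'a) \<Rightarrow> complex set" where
  "spectrum_on H T = {z. \<not> (bij_betw (\<lambda>v. z *\<^sub>C v - T v) H H \<and>
     (\<exists>K. \<forall>v\<in>H. norm v \<le> K * norm (z *\<^sub>C v - T v)))}"

definition resolvent_on ::
  "'a::complex_normed_vector set \<Rightarrow> ('a \<Rightarrow> 'a) \<Rightarrow> complex \<Rightarrow> 'a \<Rightarrow> 'a" where
  "resolvent_on H T z = inv_into H (\<lambda>v. z *\<^sub>C v - T v)"

definition eigenvector_on ::
  "'a::complex_normed_vector set \<Rightarrow> ('a \<Rightarrow> 'a) \<Rightarrow> complex \<Rightarrow> 'a \<Rightarrow> bool" where
  "eigenvector_on H T z v \<longleftrightarrow> v \<in> H \<and> v \<noteq> 0 \<and> T v = z *\<^sub>C v"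

definition eigenvalue_on ::
  "'a::complex_normed_vector set \<Rightarrow> ('a \<Rightarrow> 'a) \<Rightarrow> complex \<Rightarrow> bool" where
  "eigenvalue_on H T z \<longleftrightarrow> (\<exists>v. eigenvector_on H T z v)"

section \<open>Graphs and their adjacency operators\<close>

text \<open>Graphs are simple and undirected; the edge \<open>{v, w}\<close> is represented by the two pairs
  \<open>(v, w)\<close> and \<open>(w, v)\<close>.\<close>

definition bounded_degree_graph :: "'a set \<Rightarrow> ('a \<times> 'a) set \<Rightarrow> bool" where
  "bounded_degree_graph V E \<longleftrightarrow>
     E \<subseteq> V \<times> V \<and> sym E \<and> irrefl E \<and>
     (\<exists>d. \<forall>v\<in>V. finite (E `` {v}) \<and> card (E `` {v}) \<le> d)"

text \<open>\<open>Abs_ell2\<close> is unspecified on functions that are not square-summable; the matrices used below all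
  give square-summable images (see \<open>matrix_op_apply\<close> and the \<open>sparse_matrix\<close> lemmas).\<close>

definition matrix_op :: "('a \<Rightarrow> 'b \<Rightarrow> complex) \<Rightarrow> 'b ell2 \<Rightarrow> 'a ell2" where
  "matrix_op M f = Abs_ell2 (\<lambda>a. \<Sum>\<^sub>\<infinity>b. M a b * ell2_apply f b)"

definition adjacency_op :: "('a \<times> 'a) set \<Rightarrow> 'a ell2 \<Rightarrow> 'a ell2" where
  "adjacency_op E = matrix_op (\<lambda>v w. of_bool ((v, w) \<in> E))"

section \<open>Modifying a graph and linking another graph to it\<close>

text \<open>\<open>Y\<close> lives on the disjoint union of the two vertex sets. Its edges inside \<open>X\<close> and its edges between
  \<open>X\<close> and \<open>G\<close> are arbitrary, while inside \<open>G\<close> they are those of \<open>G\<close>.\<close>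

definition obtained_by_linking ::
  "'x set \<Rightarrow> 'g set \<Rightarrow> ('g \<times> 'g) set \<Rightarrow> (('x + 'g) \<times> ('x + 'g)) set \<Rightarrow> bool" where
  "obtained_by_linking V\<^sub>X V\<^sub>G E\<^sub>G E\<^sub>Y \<longleftrightarrow>
     bounded_degree_graph (V\<^sub>X <+> V\<^sub>G) E\<^sub>Y \<and>
     (\<forall>g h. (Inr g, Inr h) \<in> E\<^sub>Y \<longleftrightarrow> (g, h) \<in> E\<^sub>G)"

text \<open>The matrix of \<open>D\<close> has entry \<open>1\<close> for an added and \<open>-1\<close> for a removed edge of \<open>X\<close>.\<close>

definition change_op ::
  "('x \<times> 'x) set \<Rightarrow> (('x + 'g) \<times> ('x + 'g)) set \<Rightarrow> 'x ell2 \<Rightarrow> 'x ell2" where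
  "change_op E\<^sub>X E\<^sub>Y =
     matrix_op (\<lambda>v w. of_bool ((Inl v, Inl w) \<in> E\<^sub>Y) - of_bool ((v, w) \<in> E\<^sub>X))"

definition link_op :: "(('x + 'g) \<times> ('x + 'g)) set \<Rightarrow> 'g ell2 \<Rightarrow> 'x ell2" where
  "link_op E\<^sub>Y = matrix_op (\<lambda>v g. of_bool ((Inl v, Inr g) \<in> E\<^sub>Y))"

definition link_op_transpose :: "(('x + 'g) \<times> ('x + 'g)) set \<Rightarrow> 'x ell2 \<Rightarrow> 'g ell2" where
  "link_op_transpose E\<^sub>Y = matrix_op (\<lambda>g v. of_bool ((Inl v, Inr g) \<in> E\<^sub>Y))"

definition block_op ::
  "('a \<Rightarrow> 'a::plus) \<Rightarrow> ('b \<Rightarrow> 'a) \<Rightarrow> ('a \<Rightarrow> 'b::plus) \<Rightarrow> ('b \<Rightarrow> 'b) \<Rightarrow> 'a \<times> 'b \<Rightarrow> 'a \<times> 'b" where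
  "block_op P Q R S = (\<lambda>(x, y). (P x + Q y, R x + S y))"

section \<open>Well-definedness\<close>

text \<open>Matrices with uniformly bounded entries and uniformly many nonzero entries in rows and columns
  (Schur test) give bounded operators, so that \<open>matrix_op\<close> is meaningful for all the matrices above.\<close>

definition sparse_matrix :: "('a \<Rightarrow> 'b \<Rightarrow> complex) \<Rightarrow> nat \<Rightarrow> bool" where
  "sparse_matrix M d \<longleftrightarrow> (\<forall>a b. cmod (M a b) \<le> 1) \<and>
     (\<forall>a. finite {b. M a b \<noteq> 0} \<and> card {b. M a b \<noteq> 0} \<le> d) \<and>
     (\<forall>b. finite {a. M a b \<noteq> 0} \<and> card {a. M a b \<noteq> 0} \<le> d)"

lemma sparse_infsum:
  assumes "sparse_matrix M d"
  shows "(\<Sum>\<^sub>\<infinity>b. M a b * f b) = (\<Sum>b\<in>{b. M a b \<noteq> 0}. M a b * f b)"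
proof -
  have "(\<Sum>\<^sub>\<infinity>b. M a b * f b) = (\<Sum>\<^sub>\<infinity>b\<in>{b. M a b \<noteq> 0}. M a b * f b)"
    by (rule infsum_cong_neutral) auto
  then show ?thesis using assms by (simp add: sparse_matrix_def)
qed

lemma sparse_square_bound:
  assumes M: "sparse_matrix M d" and F: "finite F"
  shows "(\<Sum>a\<in>F. (cmod (\<Sum>\<^sub>\<infinity>b. M a b * ell2_apply f b))\<^sup>2) \<le> (real d * norm f)\<^sup>2"
proof -
  define N where "N a = {b. M a b \<noteq> 0}" for a
  define U where "U = (\<Union>a\<in>F. N a)"
  define q where "q b = (cmod (ell2_apply f b))\<^sup>2" for b
  have N: "finite (N a)" "card (N a) \<le> d" for a using M by (auto simp: sparse_matrix_def N_def)
  have U: "finite U" using F N by (auto simp: U_def)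
  have row: "(cmod (\<Sum>\<^sub>\<infinity>b. M a b * ell2_apply f b))\<^sup>2 \<le> real d * (\<Sum>b\<in>N a. q b)" for a
  proof -
    have "cmod (\<Sum>\<^sub>\<infinity>b. M a b * ell2_apply f b) \<le> (\<Sum>b\<in>N a. cmod (M a b * ell2_apply f b))"
      unfolding sparse_infsum[OF M] N_def by (rule norm_sum)
    also have "\<dots> \<le> (\<Sum>b\<in>N a. 1 * cmod (ell2_apply f b))"
      unfolding norm_mult using M by (intro sum_mono mult_right_mono) (auto simp: sparse_matrix_def)
    finally have "(cmod (\<Sum>\<^sub>\<infinity>b. M a b * ell2_apply f b))\<^sup>2 \<le> (\<Sum>b\<in>N a. 1 * cmod (ell2_apply f b))\<^sup>2"
      by (intro power_mono) auto
    also have "\<dots> \<le> (\<Sum>b\<in>N a. 1\<^sup>2) * (\<Sum>b\<in>N a. q b)"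
      unfolding q_def by (rule Cauchy_Schwarz_ineq_sum)
    also have "\<dots> \<le> real d * (\<Sum>b\<in>N a. q b)"
      using N by (intro mult_right_mono) (auto simp: q_def intro: sum_nonneg)
    finally show ?thesis .
  qed
  have "(\<Sum>a\<in>F. (cmod (\<Sum>\<^sub>\<infinity>b. M a b * ell2_apply f b))\<^sup>2) \<le> (\<Sum>a\<in>F. real d * (\<Sum>b\<in>N a. q b))"
    by (intro sum_mono row)
  also have "\<dots> = real d * (\<Sum>a\<in>F. \<Sum>b\<in>U. if b \<in> N a then q b else 0)"
    unfolding sum_distrib_left[symmetric]
    by (intro arg_cong2[where f = times] refl sum.cong sum.mono_neutral_cong_left U) (auto simp: U_def)
  also have "\<dots> = real d * (\<Sum>b\<in>U. \<Sum>a\<in>F. if b \<in> N a then q b else 0)"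
    by (subst sum.swap) simp
  also have "\<dots> \<le> real d * (\<Sum>b\<in>U. real d * q b)"
  proof (intro mult_left_mono sum_mono)
    fix b
    have "card (F \<inter> {a. b \<in> N a}) \<le> card {a. M a b \<noteq> 0}"
      using M by (intro card_mono) (auto simp: sparse_matrix_def N_def)
    also have "\<dots> \<le> d" using M by (auto simp: sparse_matrix_def)
    finally have "real (card (F \<inter> {a. b \<in> N a})) * q b \<le> real d * q b"
      by (intro mult_right_mono) (auto simp: q_def)
    then show "(\<Sum>a\<in>F. if b \<in> N a then q b else 0) \<le> real d * q b"
      using F by (simp add: sum.If_cases)
  qed auto
  also have "\<dots> = (real d)\<^sup>2 * (\<Sum>b\<in>U. q b)"
    by (simp add: sum_distrib_left power2_eq_square algebra_simps)
  also have "\<dots> \<le> (real d)\<^sup>2 * (\<Sum>\<^sub>\<infinity>b. q b)"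
    by (intro mult_left_mono finite_sum_le_infsum U) (auto simp: q_def ell2_summable)
  also have "(\<Sum>\<^sub>\<infinity>b. q b) = (norm f)\<^sup>2"
    by (simp add: q_def norm_ell2.rep_eq infsum_nonneg)
  finally show ?thesis by (simp add: power_mult_distrib)
qed

lemma row_summable:
  assumes "sparse_matrix M d"
  shows "(\<lambda>b. M a b * f b) summable_on UNIV"
proof (rule finite_nonzero_values_imp_summable_on)
  have "finite {b. M a b \<noteq> 0}" using assms by (simp add: sparse_matrix_def)
  then show "finite {b \<in> UNIV. M a b * f b \<noteq> 0}" by (rule rev_finite_subset) auto
qed

lemma matrix_op_apply:
  assumes "sparse_matrix M d"
  shows "ell2_apply (matrix_op M f) a = (\<Sum>\<^sub>\<infinity>b. M a b * ell2_apply f b)"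
proof -
  have "(\<lambda>a. (cmod (\<Sum>\<^sub>\<infinity>b. M a b * ell2_apply f b))\<^sup>2) summable_on UNIV"
    by (rule square_summableI) (rule sparse_square_bound[OF assms])
  then show ?thesis by (simp add: matrix_op_def Abs_ell2_inverse)
qed

lemma matrix_op_apply_sum:
  assumes "sparse_matrix M d"
  shows "ell2_apply (matrix_op M f) a = (\<Sum>b\<in>{b. M a b \<noteq> 0}. M a b * ell2_apply f b)"
  by (simp add: matrix_op_apply[OF assms] sparse_infsum[OF assms])

lemma matrix_op_scaleC:
  assumes "sparse_matrix M d"
  shows "matrix_op M (c *\<^sub>C f) = c *\<^sub>C matrix_op M f"
  by (rule ell2_eqI)
    (simp add: matrix_op_apply_sum[OF assms] scaleC_ell2.rep_eq sum_distrib_left algebra_simps)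

lemma bounded_linear_matrix_op:
  assumes "sparse_matrix M d"
  shows "bounded_linear (matrix_op M)"
proof (rule bounded_linear_intro[where K = "real d"])
  show "matrix_op M (f + g) = matrix_op M f + matrix_op M g" for f g
    by (rule ell2_eqI)
      (simp add: matrix_op_apply_sum[OF assms] plus_ell2.rep_eq sum.distrib algebra_simps)
  show "matrix_op M (r *\<^sub>R f) = r *\<^sub>R matrix_op M f" for r f
    by (simp add: scaleR_scaleC matrix_op_scaleC[OF assms])
  show "norm (matrix_op M f) \<le> norm f * real d" for f
  proof -
    have *: "(\<Sum>a\<in>F. (cmod (ell2_apply (matrix_op M f) a))\<^sup>2) \<le> (real d * norm f)\<^sup>2"
      if "finite F" for F
      using sparse_square_bound[OF assms that] by (simp add: matrix_op_apply[OF assms])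
    have "(\<Sum>\<^sub>\<infinity>a. (cmod (ell2_apply (matrix_op M f) a))\<^sup>2) \<le> (real d * norm f)\<^sup>2"
      by (rule infsum_le_finite_sums[OF ell2_summable]) (use * in auto)
    then show ?thesis
      by (auto simp: norm_ell2.rep_eq[of "matrix_op M f"] mult.commute intro!: real_le_lsqrt)
  qed
qed

lemma sparse_adjacency:
  assumes "bounded_degree_graph V E"
  shows "\<exists>d. sparse_matrix (\<lambda>v w. of_bool ((v, w) \<in> E)) d"
proof -
  from assms obtain d where d: "\<forall>v\<in>V. finite (E `` {v}) \<and> card (E `` {v}) \<le> d"
    and E: "E \<subseteq> V \<times> V" "sym E" by (auto simp: bounded_degree_graph_def)
  have row: "finite {w. (v, w) \<in> E} \<and> card {w. (v, w) \<in> E} \<le> d" for v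
  proof (cases "v \<in> V")
    case True
    have "{w. (v, w) \<in> E} = E `` {v}" by auto
    then show ?thesis using True d by simp
  next
    case False
    then have "{w. (v, w) \<in> E} = {}" using E by auto
    then show ?thesis by (simp only: finite.emptyI card.empty le0 simp_thms)
  qed
  have "(v, w) \<in> E \<longleftrightarrow> (w, v) \<in> E" for v w using E by (auto simp: sym_def)
  then have col: "{v. (v, w) \<in> E} = {v. (w, v) \<in> E}" for w by blast
  have "sparse_matrix (\<lambda>v w. of_bool ((v, w) \<in> E)) d"
    unfolding sparse_matrix_def of_bool_eq_0_iff not_not col using row by simp
  then show ?thesis ..
qed

lemma sparse_transpose: "sparse_matrix M d \<Longrightarrow> sparse_matrix (\<lambda>a b. M b a) d"
  by (auto simp: sparse_matrix_def)

lemma finite_card_preimage_le: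
  assumes "inj q" "finite {c. N c} \<and> card {c. N c} \<le> d"
  shows "finite {b. N (q b)} \<and> card {b. N (q b)} \<le> d"
proof -
  have "q ` {b. N (q b)} \<subseteq> {c. N c}" "inj_on q {b. N (q b)}"
    using assms(1) by (auto intro: inj_on_subset)
  then show ?thesis
    using assms(2) by (meson card_inj_on_le inj_on_finite le_trans)
qed

lemma sparse_reindex:
  assumes M: "sparse_matrix M d" and p: "inj p" and q: "inj q"
  shows "sparse_matrix (\<lambda>a b. M (p a) (q b)) d"
proof -
  have "finite {b. M (p a) (q b) \<noteq> 0} \<and> card {b. M (p a) (q b) \<noteq> 0} \<le> d" for a
    by (rule finite_card_preimage_le[OF q, of "\<lambda>c. M (p a) c \<noteq> 0"])
      (use M in \<open>simp add: sparse_matrix_def\<close>)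
  moreover have "finite {a. M (p a) (q b) \<noteq> 0} \<and> card {a. M (p a) (q b) \<noteq> 0} \<le> d" for b
    by (rule finite_card_preimage_le[OF p, of "\<lambda>c. M c (q b) \<noteq> 0"])
      (use M in \<open>simp add: sparse_matrix_def\<close>)
  ultimately show ?thesis using M by (simp add: sparse_matrix_def)
qed

lemma sparse_diff:
  assumes "bounded_degree_graph V\<^sub>X E\<^sub>X" "bounded_degree_graph V\<^sub>Y E\<^sub>Y"
  shows "\<exists>d. sparse_matrix
    (\<lambda>v w. of_bool ((Inl v, Inl w) \<in> E\<^sub>Y) - of_bool ((v, w) \<in> E\<^sub>X) :: complex) d"
proof -
  obtain d where d: "sparse_matrix (\<lambda>v w. of_bool ((v, w) \<in> E\<^sub>X)) d"
    using sparse_adjacency[OF assms(1)] ..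
  obtain e where e0: "sparse_matrix (\<lambda>v w. of_bool ((v, w) \<in> E\<^sub>Y)) e"
    using sparse_adjacency[OF assms(2)] ..
  have e: "sparse_matrix (\<lambda>v w. of_bool ((Inl v, Inl w) \<in> E\<^sub>Y)) e"
    using sparse_reindex[OF e0, of Inl Inl] by simp
  have fin: "finite {x. of_bool (P x) - of_bool (Q x) \<noteq> (0 :: complex)} \<and>
      card {x. of_bool (P x) - of_bool (Q x) \<noteq> (0 :: complex)} \<le> e + d"
    if "finite {x. P x} \<and> card {x. P x} \<le> e" "finite {x. Q x} \<and> card {x. Q x} \<le> d"
    for P Q :: "'a \<Rightarrow> bool"
  proof -
    have sub: "{x. of_bool (P x) - of_bool (Q x) \<noteq> (0 :: complex)} \<subseteq> {x. P x} \<union> {x. Q x}"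
      by auto
    have "card {x. of_bool (P x) - of_bool (Q x) \<noteq> (0 :: complex)} \<le> card ({x. P x} \<union> {x. Q x})"
      by (rule card_mono[OF _ sub]) (use that in auto)
    also have "\<dots> \<le> card {x. P x} + card {x. Q x}" by (rule card_Un_le)
    finally show ?thesis using that finite_subset[OF sub] by auto
  qed
  have "sparse_matrix (\<lambda>v w. of_bool ((Inl v, Inl w) \<in> E\<^sub>Y) - of_bool ((v, w) \<in> E\<^sub>X) :: complex) (e + d)"
    unfolding sparse_matrix_def
  proof (intro conjI[of "\<forall>a b. _ a b"] conjI[of "\<forall>a. _ a"] allI fin)
    show "cmod (of_bool ((Inl a, Inl b) \<in> E\<^sub>Y) - of_bool ((a, b) \<in> E\<^sub>X)) \<le> 1" for a b by auto
  qed (use d e in \<open>auto simp: sparse_matrix_def\<close>)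
  then show ?thesis ..
qed

lemma sparse_link:
  assumes "bounded_degree_graph V\<^sub>Y E\<^sub>Y"
  shows "\<exists>d. sparse_matrix (\<lambda>v g. of_bool ((Inl v, Inr g) \<in> E\<^sub>Y)) d"
proof -
  obtain d where d: "sparse_matrix (\<lambda>v w. of_bool ((v, w) \<in> E\<^sub>Y)) d"
    using sparse_adjacency[OF assms] ..
  show ?thesis using sparse_reindex[OF d, of Inl Inr] by auto
qed

lemma closed_ell2_on: "closed (ell2_on V)"
proof -
  have "continuous_on UNIV (\<lambda>f :: 'a ell2. ell2_apply f a)" for a
  proof -
    have "cmod (ell2_apply f a) \<le> norm f" for f :: "'a ell2"
      using L2_set_le_sqrt_infsum[OF ell2_summable[of f], of "{a}"] by (simp add: norm_ell2.rep_eq)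
    then have "bounded_linear (\<lambda>f. ell2_apply f a)"
      by (intro bounded_linear_intro[where K = 1])
        (auto simp: plus_ell2.rep_eq scaleR_scaleC scaleC_ell2.rep_eq scaleR_conv_of_real)
    then show ?thesis by (simp add: linear_continuous_on)
  qed
  then have "closed {f :: 'a ell2. ell2_apply f a = 0}" for a
    by (intro closed_Collect_eq) auto
  then show ?thesis unfolding ell2_on_def
    by (intro closed_Collect_all) (auto simp: closed_Collect_const imp_conv_disj closed_Collect_disj)
qed

lemma matrix_op_ell2_on:
  assumes "sparse_matrix M d" "\<And>a b. a \<notin> V \<Longrightarrow> M a b = 0"
  shows "matrix_op M f \<in> ell2_on V"
  using assms by (simp add: ell2_on_def matrix_op_apply[OF assms(1)])

lemma adjacency_op_in:
  assumes "bounded_degree_graph V E" shows "adjacency_op E f \<in> ell2_on V"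
proof -
  obtain d where "sparse_matrix (\<lambda>v w. of_bool ((v, w) \<in> E)) d"
    using sparse_adjacency[OF assms] ..
  then show ?thesis unfolding adjacency_op_def
    by (rule matrix_op_ell2_on) (use assms in \<open>auto simp: bounded_degree_graph_def\<close>)
qed

lemma change_op_in:
  assumes "bounded_degree_graph V\<^sub>X E\<^sub>X" "obtained_by_linking V\<^sub>X V\<^sub>G E\<^sub>G E\<^sub>Y"
  shows "change_op E\<^sub>X E\<^sub>Y f \<in> ell2_on V\<^sub>X"
proof -
  have Y: "bounded_degree_graph (V\<^sub>X <+> V\<^sub>G) E\<^sub>Y" using assms by (simp add: obtained_by_linking_def)
  obtain d where "sparse_matrix (\<lambda>v w. of_bool ((Inl v, Inl w) \<in> E\<^sub>Y) - of_bool ((v, w) \<in> E\<^sub>X) :: complex) d"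
    using sparse_diff[OF assms(1) Y] ..
  then show ?thesis unfolding change_op_def
    by (rule matrix_op_ell2_on) (use assms Y in \<open>auto simp: bounded_degree_graph_def\<close>)
qed

lemma link_op_in:
  assumes "obtained_by_linking V\<^sub>X V\<^sub>G E\<^sub>G E\<^sub>Y"
  shows "link_op E\<^sub>Y f \<in> ell2_on V\<^sub>X" "link_op_transpose E\<^sub>Y h \<in> ell2_on V\<^sub>G"
proof -
  have Y: "bounded_degree_graph (V\<^sub>X <+> V\<^sub>G) E\<^sub>Y" using assms by (simp add: obtained_by_linking_def)
  obtain d where d: "sparse_matrix (\<lambda>v g. of_bool ((Inl v, Inr g) \<in> E\<^sub>Y)) d"
    using sparse_link[OF Y] ..
  show "link_op E\<^sub>Y f \<in> ell2_on V\<^sub>X" unfolding link_op_def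
    by (rule matrix_op_ell2_on[OF d]) (use Y in \<open>auto simp: bounded_degree_graph_def\<close>)
  show "link_op_transpose E\<^sub>Y h \<in> ell2_on V\<^sub>G" unfolding link_op_transpose_def
    by (rule matrix_op_ell2_on[OF sparse_transpose[OF d]])
      (use Y in \<open>auto simp: bounded_degree_graph_def\<close>)
qed

text \<open>Under the canonical isometry of \<open>\<ell>\<^sup>2(X) \<oplus> \<ell>\<^sup>2(G)\<close> with \<open>\<ell>\<^sup>2(X \<union> G)\<close>, the adjacency operator of
  \<open>Y\<close> is the block operator with entries \<open>A + D\<close>, \<open>C\<close>, the transpose of \<open>C\<close>, and \<open>B\<close>.\<close>

definition ell2_join :: "'x ell2 \<times> 'g ell2 \<Rightarrow> ('x + 'g) ell2" where
  "ell2_join p = Abs_ell2 (case_sum (ell2_apply (fst p)) (ell2_apply (snd p)))"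

lemma has_sum_case_sum:
  fixes u :: "'x \<Rightarrow> 'c::{topological_comm_monoid_add,t2_space}"
  assumes "u summable_on UNIV" "w summable_on UNIV"
  shows "(case_sum u w has_sum infsum u UNIV + infsum w UNIV) UNIV"
proof -
  have "(case_sum u w has_sum infsum u UNIV) (range Inl)"
    using has_sum_infsum[OF assms(1)] by (subst has_sum_reindex) (auto simp: o_def)
  moreover have "(case_sum u w has_sum infsum w UNIV) (range Inr)"
    using has_sum_infsum[OF assms(2)] by (subst has_sum_reindex) (auto simp: o_def)
  ultimately have "(case_sum u w has_sum infsum u UNIV + infsum w UNIV) (range Inl \<union> range Inr)"
    by (rule has_sum_Un_disjoint) auto
  then show ?thesis by (simp add: UNIV_sum)
qed

lemma ell2_join_aux:
  "((\<lambda>c. (cmod (case_sum (ell2_apply f) (ell2_apply g) c))\<^sup>2) has_sum (norm f)\<^sup>2 + (norm g)\<^sup>2) UNIV"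
proof -
  have "(\<lambda>c. (cmod (case_sum (ell2_apply f) (ell2_apply g) c))\<^sup>2)
      = case_sum (\<lambda>a. (cmod (ell2_apply f a))\<^sup>2) (\<lambda>b. (cmod (ell2_apply g b))\<^sup>2)"
    by (auto split: sum.split)
  then show ?thesis
    using has_sum_case_sum[OF ell2_summable[of f] ell2_summable[of g]]
    by (simp add: norm_ell2.rep_eq infsum_nonneg)
qed

lemma ell2_join_apply:
  "ell2_apply (ell2_join p) = case_sum (ell2_apply (fst p)) (ell2_apply (snd p))"
proof -
  have "(\<lambda>c. (cmod (case_sum (ell2_apply (fst p)) (ell2_apply (snd p)) c))\<^sup>2) summable_on UNIV"
    using ell2_join_aux by (rule has_sum_imp_summable)
  then show ?thesis by (simp add: ell2_join_def Abs_ell2_inverse)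
qed

lemma norm_ell2_join: "norm (ell2_join p) = norm p"
  using ell2_join_aux[of "fst p" "snd p"]
  by (simp add: norm_ell2.rep_eq[of "ell2_join p"] ell2_join_apply norm_prod_def infsumI)

lemma ell2_join_linear:
  "ell2_join (p + q) = ell2_join p + ell2_join q" "ell2_join (c *\<^sub>C p) = c *\<^sub>C ell2_join p"
  by (auto intro!: ell2_eqI split: sum.split
      simp: ell2_join_apply plus_ell2.rep_eq scaleC_ell2.rep_eq scaleC_prod_def)

lemma bij_betw_ell2_join:
  "bij_betw ell2_join (ell2_on V\<^sub>X \<times> ell2_on V\<^sub>G) (ell2_on (V\<^sub>X <+> V\<^sub>G))"
proof (rule bij_betw_imageI)
  show "inj_on ell2_join (ell2_on V\<^sub>X \<times> ell2_on V\<^sub>G)"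
  proof (rule inj_onI)
    fix p q :: "'a ell2 \<times> 'b ell2"
    assume eq: "ell2_join p = ell2_join q"
    have "ell2_apply (fst p) a = ell2_apply (fst q) a" for a
      using arg_cong[OF eq, of "\<lambda>f. ell2_apply f (Inl a)"] by (simp add: ell2_join_apply)
    moreover have "ell2_apply (snd p) b = ell2_apply (snd q) b" for b
      using arg_cong[OF eq, of "\<lambda>f. ell2_apply f (Inr b)"] by (simp add: ell2_join_apply)
    ultimately show "p = q" by (simp add: prod_eq_iff ell2_eqI)
  qed
  show "ell2_join ` (ell2_on V\<^sub>X \<times> ell2_on V\<^sub>G) = ell2_on (V\<^sub>X <+> V\<^sub>G)"
  proof (intro equalityI subsetI)
    fix f assume "f \<in> ell2_join ` (ell2_on V\<^sub>X \<times> ell2_on V\<^sub>G)"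
    then show "f \<in> ell2_on (V\<^sub>X <+> V\<^sub>G)"
      by (auto simp: ell2_on_def ell2_join_apply split: sum.split)
  next
    fix f :: "('a + 'b) ell2"
    assume f: "f \<in> ell2_on (V\<^sub>X <+> V\<^sub>G)"
    have sum: "(\<lambda>c. (cmod (ell2_apply f c))\<^sup>2) summable_on R" for R
      using ell2_summable by (rule summable_on_subset_banach) simp
    have "(\<lambda>a. (cmod (ell2_apply f (Inl a)))\<^sup>2) summable_on UNIV"
      using sum[of "range Inl"] by (subst (asm) summable_on_reindex) (auto simp: o_def)
    then have l: "ell2_apply (Abs_ell2 (\<lambda>a. ell2_apply f (Inl a))) = (\<lambda>a. ell2_apply f (Inl a))"
      by (simp add: Abs_ell2_inverse)
    have "(\<lambda>a. (cmod (ell2_apply f (Inr a)))\<^sup>2) summable_on UNIV"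
      using sum[of "range Inr"] by (subst (asm) summable_on_reindex) (auto simp: o_def)
    then have r: "ell2_apply (Abs_ell2 (\<lambda>a. ell2_apply f (Inr a))) = (\<lambda>a. ell2_apply f (Inr a))"
      by (simp add: Abs_ell2_inverse)
    let ?p = "(Abs_ell2 (\<lambda>a. ell2_apply f (Inl a)), Abs_ell2 (\<lambda>a. ell2_apply f (Inr a)))"
    have "f = ell2_join ?p"
      by (rule ell2_eqI) (auto simp: ell2_join_apply l r split: sum.split)
    moreover have "?p \<in> ell2_on V\<^sub>X \<times> ell2_on V\<^sub>G"
      using f by (auto simp: ell2_on_def l r)
    ultimately show "f \<in> ell2_join ` (ell2_on V\<^sub>X \<times> ell2_on V\<^sub>G)" by blast
  qed
qed

lemma adjacency_op_linked:
  assumes X: "bounded_degree_graph V\<^sub>X E\<^sub>X" and G: "bounded_degree_graph V\<^sub>G E\<^sub>G"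
    and link: "obtained_by_linking V\<^sub>X V\<^sub>G E\<^sub>G E\<^sub>Y"
  shows "adjacency_op E\<^sub>Y (ell2_join p) =
    ell2_join (block_op (\<lambda>x. adjacency_op E\<^sub>X x + change_op E\<^sub>X E\<^sub>Y x) (link_op E\<^sub>Y)
      (link_op_transpose E\<^sub>Y) (adjacency_op E\<^sub>G) p)"
proof -
  have Y: "bounded_degree_graph (V\<^sub>X <+> V\<^sub>G) E\<^sub>Y" and inG: "(Inr g, Inr h) \<in> E\<^sub>Y \<longleftrightarrow> (g, h) \<in> E\<^sub>G" for g h
    using link by (auto simp: obtained_by_linking_def)
  obtain x y where p: "p = (x, y)" by force
  obtain dY where dY: "sparse_matrix (\<lambda>v w. of_bool ((v, w) \<in> E\<^sub>Y)) dY"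
    using sparse_adjacency[OF Y] ..
  obtain dX where dX: "sparse_matrix (\<lambda>v w. of_bool ((v, w) \<in> E\<^sub>X)) dX"
    using sparse_adjacency[OF X] ..
  obtain dG where dG: "sparse_matrix (\<lambda>v w. of_bool ((v, w) \<in> E\<^sub>G)) dG"
    using sparse_adjacency[OF G] ..
  obtain dD where dD: "sparse_matrix
      (\<lambda>v w. of_bool ((Inl v, Inl w) \<in> E\<^sub>Y) - of_bool ((v, w) \<in> E\<^sub>X) :: complex) dD"
    using sparse_diff[OF X Y] ..
  obtain dC where dC: "sparse_matrix (\<lambda>v g. of_bool ((Inl v, Inr g) \<in> E\<^sub>Y)) dC"
    using sparse_link[OF Y] ..
  have symE: "(u, v) \<in> E\<^sub>Y \<longleftrightarrow> (v, u) \<in> E\<^sub>Y" for u v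
    using Y by (auto simp: bounded_degree_graph_def sym_def)
  have split: "(\<Sum>\<^sub>\<infinity>c. of_bool ((u, c) \<in> E\<^sub>Y) * case_sum f g c)
     = (\<Sum>\<^sub>\<infinity>a. of_bool ((u, Inl a) \<in> E\<^sub>Y) * f a) + (\<Sum>\<^sub>\<infinity>b. of_bool ((u, Inr b) \<in> E\<^sub>Y) * g b)"
    for u and f :: "'a \<Rightarrow> complex" and g
  proof -
    have fin: "finite {c. (u, c) \<in> E\<^sub>Y}" using dY by (auto simp: sparse_matrix_def)
    have 1: "(\<lambda>a. of_bool ((u, Inl a) \<in> E\<^sub>Y) * f a) summable_on UNIV"
      by (rule finite_nonzero_values_imp_summable_on, rule finite_subset[OF _ finite_vimageI[OF fin, of Inl]])
        auto
    have 2: "(\<lambda>b. of_bool ((u, Inr b) \<in> E\<^sub>Y) * g b) summable_on UNIV"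
      by (rule finite_nonzero_values_imp_summable_on, rule finite_subset[OF _ finite_vimageI[OF fin, of Inr]])
        auto
    have "(\<lambda>c. of_bool ((u, c) \<in> E\<^sub>Y) * case_sum f g c) =
       case_sum (\<lambda>a. of_bool ((u, Inl a) \<in> E\<^sub>Y) * f a) (\<lambda>b. of_bool ((u, Inr b) \<in> E\<^sub>Y) * g b)"
      by (auto split: sum.split)
    then show ?thesis using has_sum_case_sum[OF 1 2] by (simp add: infsumI)
  qed
  have AD: "(\<Sum>\<^sub>\<infinity>w. of_bool ((Inl v, Inl w) \<in> E\<^sub>Y) * ell2_apply x w)
     = (\<Sum>\<^sub>\<infinity>w. of_bool ((v, w) \<in> E\<^sub>X) * ell2_apply x w) +
       (\<Sum>\<^sub>\<infinity>w. (of_bool ((Inl v, Inl w) \<in> E\<^sub>Y) - of_bool ((v, w) \<in> E\<^sub>X)) * ell2_apply x w)" for v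
  proof -
    have "(\<lambda>w. of_bool ((v, w) \<in> E\<^sub>X) * ell2_apply x w) summable_on UNIV"
      by (rule row_summable[OF dX])
    moreover have "(\<lambda>w. (of_bool ((Inl v, Inl w) \<in> E\<^sub>Y) - of_bool ((v, w) \<in> E\<^sub>X)) * ell2_apply x w) summable_on UNIV"
      by (rule row_summable[OF dD])
    ultimately show ?thesis
      by (subst infsum_add[symmetric]) (simp_all add: left_diff_distrib)
  qed
  note applies = ell2_join_apply block_op_def adjacency_op_def change_op_def
    link_op_def link_op_transpose_def plus_ell2.rep_eq matrix_op_apply[OF dY] matrix_op_apply[OF dX]
    matrix_op_apply[OF dG] matrix_op_apply[OF dD] matrix_op_apply[OF dC]
    matrix_op_apply[OF sparse_transpose[OF dC]] split
  show ?thesis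
  proof (rule ell2_eqI)
    fix c
    show "ell2_apply (adjacency_op E\<^sub>Y (ell2_join p)) c = ell2_apply (ell2_join
      (block_op (\<lambda>x. adjacency_op E\<^sub>X x + change_op E\<^sub>X E\<^sub>Y x) (link_op E\<^sub>Y)
        (link_op_transpose E\<^sub>Y) (adjacency_op E\<^sub>G) p)) c"
    proof (cases c)
      case (Inl v)
      then show ?thesis by (simp add: p applies AD)
    next
      case (Inr g)
      have "of_bool ((Inr g, Inl v) \<in> E\<^sub>Y) = (of_bool ((Inl v, Inr g) \<in> E\<^sub>Y) :: complex)" for v
        by (simp add: symE[of "Inr g" "Inl v"])
      with Inr show ?thesis by (simp add: p applies inG)
    qed
  qed
qed

end

theory Submission
  imports Defs
begin

text \<open>The equation \<open>A\<^sub>p (x, y) = \<mu> (x, y)\<close> reads \<open>(\<mu> - A) x = D x + C y\<close> and \<open>(\<mu> - B) y = C\<^sup>t x\<close>.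
  Both left-hand sides are invertible, so with \<open>z = D x + C y\<close> it is equivalent to
  \<open>x = R\<^sub>A z\<close>, \<open>y = R\<^sub>B (C\<^sup>t x)\<close> and \<open>z = D x + C y = S z\<close>, a Schur complement elimination.\<close>

lemma scaleC_zero_right [simp]: "c *\<^sub>C (0 :: 'a::complex_normed_vector) = 0"
  using norm_scaleC[of c "0 :: 'a"] by simp

lemma resolvent_on_in:
  assumes "z \<notin> spectrum_on H T" "v \<in> H"
  shows "resolvent_on H T z v \<in> H"
  using assms by (auto simp: spectrum_on_def resolvent_on_def bij_betw_def intro: inv_into_into)

text \<open>Rests on the injectivity of \<open>\<lambda>v. z *\<^sub>C v - T v\<close> on
  \<open>H\<close>; it recovers the components of an eigenvector from the rearranged rows of the
  eigenvalue equation.\<close>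

lemma resolvent_on_inverse_left:
  assumes "z \<notin> spectrum_on H T" "v \<in> H"
  shows "resolvent_on H T z (z *\<^sub>C v - T v) = v"
  using assms bij_betw_inv_into_left[of "\<lambda>v. z *\<^sub>C v - T v" H H v]
  by (simp add: spectrum_on_def resolvent_on_def)

text \<open>Rests on surjectivity onto \<open>H\<close>; it turns vectors defined through resolvents
  into solutions of the two rows.\<close>

lemma resolvent_on_inverse_right:
  assumes "z \<notin> spectrum_on H T" "v \<in> H"
  shows "z *\<^sub>C resolvent_on H T z v - T (resolvent_on H T z v) = v"
  using assms bij_betw_inv_into_right[of "\<lambda>v. z *\<^sub>C v - T v" H H v]
  by (simp add: spectrum_on_def resolvent_on_def)

text \<open>Here \<open>T\<close> is an arbitrary function, so its value at \<open>0\<close> stands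
  in for linearity: \<open>0\<close> is its own image under
  \<open>\<lambda>v. z *\<^sub>C v - T v\<close>, hence its own preimage.\<close>

lemma resolvent_on_zero:
  assumes "z \<notin> spectrum_on H T" "0 \<in> H" "T 0 = 0"
  shows "resolvent_on H T z 0 = 0"
  using resolvent_on_inverse_left[OF assms(1,2)] assms(3) by simp

text \<open>Elimination for abstract maps: \<open>H\<close> and \<open>K\<close> play the roles of
  the two summands and \<open>L\<close> that of the domain of \<open>S\<close>. Each row of the
  block equation is solved for the component on which its resolvent acts.\<close>

lemma eigenvector_block_imp_schur:
  assumes \<mu>: "\<mu> \<notin> spectrum_on H A" "\<mu> \<notin> spectrum_on K B"
    and zero: "0 \<in> H" "0 \<in> K" "A 0 = 0" "B 0 = 0" "Ct 0 = 0"
    and sub: "\<And>x y. x \<in> H \<Longrightarrow> y \<in> K \<Longrightarrow> D x + C y \<in> L"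
    and S: "\<And>z. S z = D (resolvent_on H A \<mu> z) +
      C (resolvent_on K B \<mu> (Ct (resolvent_on H A \<mu> z)))"
    and ev: "eigenvector_on (H \<times> K) (block_op (\<lambda>x. A x + D x) C Ct B) \<mu> (x, y)"
  defines "z \<equiv> D x + C y"
  shows "x = resolvent_on H A \<mu> z" "y = resolvent_on K B \<mu> (Ct (resolvent_on H A \<mu> z))"
    "eigenvector_on L S 1 z"
proof -
  have x: "x \<in> H" and y: "y \<in> K" and ne: "(x, y) \<noteq> 0"
    and eqx: "A x + D x + C y = \<mu> *\<^sub>C x" and eqy: "Ct x + B y = \<mu> *\<^sub>C y"
    using ev by (auto simp: eigenvector_on_def block_op_def scaleC_prod_def)
  \<comment> \<open>The first row, with \<open>A x\<close> moved to the side of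
    \<open>\<mu> *\<^sub>C x\<close>.\<close>
  have "z = \<mu> *\<^sub>C x - A x" unfolding z_def eqx[symmetric] by simp
  then show Rx: "x = resolvent_on H A \<mu> z" using resolvent_on_inverse_left[OF \<mu>(1) x] by simp
  have "Ct x = \<mu> *\<^sub>C y - B y" unfolding eqy[symmetric] by simp
  then have Ry: "y = resolvent_on K B \<mu> (Ct x)" using resolvent_on_inverse_left[OF \<mu>(2) y] by simp
  then show Ry': "y = resolvent_on K B \<mu> (Ct (resolvent_on H A \<mu> z))"
    unfolding Rx[symmetric] .
  \<comment> \<open>The pair is determined by \<open>z\<close>: if \<open>z\<close> vanished, then
    so would \<open>x\<close>, and then \<open>y\<close> as the resolvent of \<open>B\<close>
    applied to \<open>Ct 0\<close>.\<close>
  have "z \<noteq> 0"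
  proof
    assume "z = 0"
    then have "x = 0" using Rx resolvent_on_zero[OF \<mu>(1)] zero by simp
    moreover from this have "y = 0" using Ry resolvent_on_zero[OF \<mu>(2)] zero by simp
    ultimately show False using ne by (simp add: zero_prod_def)
  qed
  \<comment> \<open>Once both resolvent expressions are replaced by \<open>x\<close> and
    \<open>y\<close>, the formula for \<open>S z\<close> becomes the definition of
    \<open>z\<close>.\<close>
  moreover have "S z = z"
    unfolding S Rx[symmetric] Ry[symmetric] by (simp add: z_def)
  ultimately show "eigenvector_on L S 1 z"
    using sub[OF x y] by (simp add: eigenvector_on_def scaleC_one z_def)
qed

text \<open>The converse reads the same elimination backwards. The inclusion
  \<open>L \<subseteq> H\<close> places \<open>z\<close> where the resolvent of \<open>A\<close> is
  a genuine inverse, and \<open>Ct\<close> mapping \<open>H\<close> into \<open>K\<close> does the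
  same for the resolvent of \<open>B\<close>.\<close>

lemma eigenvector_schur_imp_block:
  assumes \<mu>: "\<mu> \<notin> spectrum_on H A" "\<mu> \<notin> spectrum_on K B"
    and "A 0 = 0" "L \<subseteq> H" and Ct: "\<And>x. x \<in> H \<Longrightarrow> Ct x \<in> K"
    and S: "\<And>z. S z = D (resolvent_on H A \<mu> z) +
      C (resolvent_on K B \<mu> (Ct (resolvent_on H A \<mu> z)))"
    and ev: "eigenvector_on L S 1 z"
  defines "x \<equiv> resolvent_on H A \<mu> z" and "y \<equiv> resolvent_on K B \<mu> (Ct (resolvent_on H A \<mu> z))"
  shows "z = D x + C y" "eigenvector_on (H \<times> K) (block_op (\<lambda>x. A x + D x) C Ct B) \<mu> (x, y)"
proof -
  have z: "z \<in> H" "z \<noteq> 0" "S z = z"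
    using ev \<open>L \<subseteq> H\<close> by (auto simp: eigenvector_on_def scaleC_one)
  show zS: "z = D x + C y" unfolding x_def y_def S[symmetric] by (rule z(3)[symmetric])
  have x: "x \<in> H" unfolding x_def by (rule resolvent_on_in[OF \<mu>(1) z(1)])
  then have y: "y \<in> K" unfolding y_def x_def[symmetric] by (intro resolvent_on_in \<mu>(2) Ct)
  have eqx: "\<mu> *\<^sub>C x - A x = z"
    unfolding x_def by (rule resolvent_on_inverse_right[OF \<mu>(1) z(1)])
  have eqy: "\<mu> *\<^sub>C y - B y = Ct x"
    unfolding y_def x_def[symmetric] by (rule resolvent_on_inverse_right[OF \<mu>(2) Ct[OF x]])
  \<comment> \<open>If \<open>x\<close> were \<open>0\<close>, then \<open>eqx\<close> would give
    \<open>z = 0\<close>. The first component alone thus makes the pair nonzero.\<close>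
  have "x \<noteq> 0" using eqx z(2) \<open>A 0 = 0\<close> by auto
  moreover have "A x + D x + C y = \<mu> *\<^sub>C x" "Ct x + B y = \<mu> *\<^sub>C y"
    using eqx zS eqy by (simp_all add: algebra_simps)
  ultimately show "eigenvector_on (H \<times> K) (block_op (\<lambda>x. A x + D x) C Ct B) \<mu> (x, y)"
    using x y by (simp add: eigenvector_on_def block_op_def scaleC_prod_def zero_prod_def)
qed

text \<open>Source of the values at zero that the elimination lemmas require of \<open>A\<close>,
  \<open>B\<close> and \<open>Ct\<close>.\<close>

lemma matrix_op_zero: "sparse_matrix M d \<Longrightarrow> matrix_op M 0 = 0"
  by (rule linear_simps(3)[OF bounded_linear_matrix_op])

lemma adjacency_op_zero:
  assumes "bounded_degree_graph V E"
  shows "adjacency_op E 0 = 0"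
proof -
  obtain d where "sparse_matrix (\<lambda>v w. of_bool ((v, w) \<in> E)) d"
    using sparse_adjacency[OF assms] ..
  then show ?thesis unfolding adjacency_op_def by (rule matrix_op_zero)
qed

lemma link_op_transpose_zero:
  assumes "obtained_by_linking V\<^sub>X V\<^sub>G E\<^sub>G E\<^sub>Y"
  shows "link_op_transpose E\<^sub>Y 0 = 0"
proof -
  have "bounded_degree_graph (V\<^sub>X <+> V\<^sub>G) E\<^sub>Y"
    using assms by (simp add: obtained_by_linking_def)
  from sparse_link[OF this] obtain d
    where d: "sparse_matrix (\<lambda>v g. of_bool ((Inl v, Inr g) \<in> E\<^sub>Y)) d" ..
  show ?thesis
    unfolding link_op_transpose_def by (rule matrix_op_zero[OF sparse_transpose[OF d]])
qed

lemma zero_in_ell2_on: "0 \<in> ell2_on V"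
  by (simp add: ell2_on_def zero_ell2.rep_eq)

lemma add_in_ell2_on: "f \<in> ell2_on V \<Longrightarrow> g \<in> ell2_on V \<Longrightarrow> f + g \<in> ell2_on V"
  by (simp add: ell2_on_def plus_ell2.rep_eq)

theorem theorem6p1:
  fixes V\<^sub>X :: "'x set" and E\<^sub>X :: "('x \<times> 'x) set"
    and V\<^sub>G :: "'g set" and E\<^sub>G :: "('g \<times> 'g) set"
    and E\<^sub>Y :: "(('x + 'g) \<times> ('x + 'g)) set"
    and A D :: "'x ell2 \<Rightarrow> 'x ell2" and B :: "'g ell2 \<Rightarrow> 'g ell2"
    and C :: "'g ell2 \<Rightarrow> 'x ell2" and Ct :: "'x ell2 \<Rightarrow> 'g ell2"
    and A\<^sub>p :: "'x ell2 \<times> 'g ell2 \<Rightarrow> 'x ell2 \<times> 'g ell2"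
    and \<mu> :: complex
    and R\<^sub>A :: "'x ell2 \<Rightarrow> 'x ell2" and R\<^sub>B :: "'g ell2 \<Rightarrow> 'g ell2"
    and H\<^sub>S :: "'x ell2 set" and S :: "'x ell2 \<Rightarrow> 'x ell2"
  assumes X: "bounded_degree_graph V\<^sub>X E\<^sub>X"
    and G: "bounded_degree_graph V\<^sub>G E\<^sub>G"
    and Y: "obtained_by_linking V\<^sub>X V\<^sub>G E\<^sub>G E\<^sub>Y"
    and A: "A = adjacency_op E\<^sub>X"
    and B: "B = adjacency_op E\<^sub>G"
    and D: "D = change_op E\<^sub>X E\<^sub>Y"
    and C: "C = link_op E\<^sub>Y"
    and Ct: "Ct = link_op_transpose E\<^sub>Y"
    and A\<^sub>p: "A\<^sub>p = block_op (\<lambda>x. A x + D x) C Ct B"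
    and \<mu>: "\<mu> \<notin> spectrum_on (ell2_on V\<^sub>X) A \<union> spectrum_on (ell2_on V\<^sub>G) B"
    and R\<^sub>A: "R\<^sub>A = resolvent_on (ell2_on V\<^sub>X) A \<mu>"
    and R\<^sub>B: "R\<^sub>B = resolvent_on (ell2_on V\<^sub>G) B \<mu>"
    and H\<^sub>S: "H\<^sub>S = closure {C y + D x | x y. x \<in> ell2_on V\<^sub>X \<and> y \<in> ell2_on V\<^sub>G}"
    and S: "S = (\<lambda>z. D (R\<^sub>A z) + C (R\<^sub>B (Ct (R\<^sub>A z))))"
  shows "(eigenvalue_on (ell2_on V\<^sub>X \<times> ell2_on V\<^sub>G) A\<^sub>p \<mu> \<longleftrightarrow> eigenvalue_on H\<^sub>S S 1) \<and>
    (\<forall>x y. eigenvector_on (ell2_on V\<^sub>X \<times> ell2_on V\<^sub>G) A\<^sub>p \<mu> (x, y) \<longrightarrow>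
       (\<exists>z. eigenvector_on H\<^sub>S S 1 z \<and> z = D x + C y \<and> x = R\<^sub>A z \<and> y = R\<^sub>B (Ct (R\<^sub>A z)))) \<and>
    (\<forall>z. eigenvector_on H\<^sub>S S 1 z \<longrightarrow>
       (\<exists>x y. eigenvector_on (ell2_on V\<^sub>X \<times> ell2_on V\<^sub>G) A\<^sub>p \<mu> (x, y) \<and>
          z = D x + C y \<and> x = R\<^sub>A z \<and> y = R\<^sub>B (Ct (R\<^sub>A z))))"
proof -
  have \<mu>': "\<mu> \<notin> spectrum_on (ell2_on V\<^sub>X) A" "\<mu> \<notin> spectrum_on (ell2_on V\<^sub>G) B" using \<mu> by auto
  have A0: "A 0 = 0" and B0: "B 0 = 0" and Ct0: "Ct 0 = 0"
    using adjacency_op_zero[OF X] adjacency_op_zero[OF G] link_op_transpose_zero[OF Y]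
    by (simp_all add: A B Ct)
  \<comment> \<open>The candidate eigenvector already lies in the sum of the two ranges, before the
    closure is taken.\<close>
  have sub: "D x + C y \<in> H\<^sub>S" if "x \<in> ell2_on V\<^sub>X" "y \<in> ell2_on V\<^sub>G" for x y
    unfolding H\<^sub>S by (rule subsetD[OF closure_subset]) (use that in \<open>auto simp: add.commute\<close>)
  have "C y + D x \<in> ell2_on V\<^sub>X" for x y
    unfolding C D by (intro add_in_ell2_on link_op_in[OF Y] change_op_in[OF X Y])
  \<comment> \<open>Both ranges lie in \<open>ell2_on V\<^sub>X\<close>, which is closed, so taking
    the closure does not leave it.\<close>
  then have HS: "H\<^sub>S \<subseteq> ell2_on V\<^sub>X"
    unfolding H\<^sub>S by (intro closure_minimal closed_ell2_on) auto
  have Ct_in: "Ct x \<in> ell2_on V\<^sub>G" for x unfolding Ct by (rule link_op_in[OF Y])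
  have S': "S z = D (resolvent_on (ell2_on V\<^sub>X) A \<mu> z) +
      C (resolvent_on (ell2_on V\<^sub>G) B \<mu> (Ct (resolvent_on (ell2_on V\<^sub>X) A \<mu> z)))" for z
    by (simp add: S R\<^sub>A R\<^sub>B)
  note schur = eigenvector_block_imp_schur[where D = D and C = C and S = S and L = H\<^sub>S,
      OF \<mu>' zero_in_ell2_on zero_in_ell2_on A0 B0 Ct0 sub S',
      folded R\<^sub>A R\<^sub>B A\<^sub>p]
  note block = eigenvector_schur_imp_block[where D = D and C = C and Ct = Ct and S = S,
      OF \<mu>' A0 HS Ct_in S', folded R\<^sub>A R\<^sub>B A\<^sub>p]
  let ?ev = "eigenvector_on (ell2_on V\<^sub>X \<times> ell2_on V\<^sub>G) A\<^sub>p \<mu>"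
  have 1: "\<exists>z. eigenvector_on H\<^sub>S S 1 z \<and> z = D x + C y \<and> x = R\<^sub>A z \<and> y = R\<^sub>B (Ct (R\<^sub>A z))"
    if "?ev (x, y)" for x y
    by (intro exI[of _ "D x + C y"] conjI refl schur that)
  have 2: "\<exists>x y. ?ev (x, y) \<and> z = D x + C y \<and> x = R\<^sub>A z \<and> y = R\<^sub>B (Ct (R\<^sub>A z))"
    if "eigenvector_on H\<^sub>S S 1 z" for z
    by (intro exI[of _ "R\<^sub>A z"] exI[of _ "R\<^sub>B (Ct (R\<^sub>A z))"] conjI refl block that)
  have "eigenvalue_on (ell2_on V\<^sub>X \<times> ell2_on V\<^sub>G) A\<^sub>p \<mu> \<longleftrightarrow> eigenvalue_on H\<^sub>S S 1"
  proof
    assume "eigenvalue_on (ell2_on V\<^sub>X \<times> ell2_on V\<^sub>G) A\<^sub>p \<mu>"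
    then obtain x y where "?ev (x, y)" by (auto simp: eigenvalue_on_def)
    from 1[OF this] show "eigenvalue_on H\<^sub>S S 1"
      unfolding eigenvalue_on_def by (elim exE conjE) (rule exI)
  next
    assume "eigenvalue_on H\<^sub>S S 1"
    then obtain z where "eigenvector_on H\<^sub>S S 1 z" by (auto simp: eigenvalue_on_def)
    from 2[OF this] show "eigenvalue_on (ell2_on V\<^sub>X \<times> ell2_on V\<^sub>G) A\<^sub>p \<mu>"
      unfolding eigenvalue_on_def by (elim exE conjE) (rule exI)
  qed
  then show ?thesis by (intro conjI allI impI 1 2)
qed

end
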